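(* For every $k \ge 5$, every convex $k$-plane geometric graph $G$ on $n$ vertices has at most $\sqrt{\frac{243}{40}k} \cdot n$ edges.
   Context: A geometric graph is a graph drawn in the plane with vertices as points in general position (no three collinear) and edges as straight-line segments. It is convex if its vertices are in convex position. Two edges cross if they share a point in their relative interiors. A geometric graph is $k$-plane if every edge crosses at most $k$ other edges of the graph. *)

theory Defs
  imports "HOL-Analysis.Analysis"
begin

type_synonym point = "real ^ 2"

definition general_position :: "point set \<Rightarrow> bool" where
  "general_position V \<longleftrightarrow> (\<forall>S. S \<subseteq> V \<and> card S = 3 \<longrightarrow> \<not> collinear S)"

definition convex_position :: "point set \<Rightarrow> bool" where
  "convex_position V \<longleftrightarrow> (\<forall>v\<in>V. v \<notin> convex hull (V - {v}))"

text \<open>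
  A geometric graph is given by its finite vertex set \<open>V\<close> and its edge set \<open>E\<close>.
  An edge is the set of its two endpoints, so the graph is simple;
  the segment representing the edge \<open>e\<close> is \<open>convex hull e\<close>.
\<close>

definition geometric_graph :: "point set \<Rightarrow> point set set \<Rightarrow> bool" where
  "geometric_graph V E \<longleftrightarrow>
     finite V \<and> general_position V \<and> E \<subseteq> {e. e \<subseteq> V \<and> card e = 2}"

definition convex_geometric_graph :: "point set \<Rightarrow> point set set \<Rightarrow> bool" where
  "convex_geometric_graph V E \<longleftrightarrow> geometric_graph V E \<and> convex_position V"

definition edges_cross :: "point set \<Rightarrow> point set \<Rightarrow> bool" where
  "edges_cross e f \<longleftrightarrow>
     e \<noteq> f \<and> rel_interior (convex hull e) \<inter> rel_interior (convex hull f) \<noteq> {}"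

definition k_plane :: "nat \<Rightarrow> point set set \<Rightarrow> bool" where
  "k_plane k E \<longleftrightarrow> (\<forall>e\<in>E. card {f \<in> E. edges_cross e f} \<le> k)"

end

theory Submission
  imports Defs
begin

text \<open>
  Convex \<open>k\<close>-plane graphs are degenerate. Suppose all degrees exceed \<open>D\<close>, put \<open>q = D div 2\<close>,
  number the vertices along the convex polygon and choose a shortest edge cutting off \<open>l \<ge> q\<close>
  vertices. All other edges on its short side have length at most \<open>q\<close>, so the \<open>t\<close>-th vertex cut
  off sends at least \<open>D + 1 - min t q - min (l + 1 - t) q\<close> edges across it; these sum to at least
  \<open>q (D - q)\<close>. Hence \<open>k < q (D - q)\<close> forces a vertex of degree at most \<open>D\<close> in every subgraph and
  thus at most \<open>D n\<close> edges. The least such \<open>D\<close> satisfies \<open>(D - 1)\<^sup>2 \<le> 4 k + 1\<close>, which yields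
  \<open>D\<^sup>2 \<le> 243 k / 40\<close> for \<open>k \<ge> 5\<close>.
\<close>

section \<open>Orientation of points in the plane\<close>

text \<open>Twice the signed area of the triangle \<open>a b c\<close>: positive for a
  counterclockwise triangle, zero for a degenerate one.\<close>

definition orient :: "point \<Rightarrow> point \<Rightarrow> point \<Rightarrow> real" where
  "orient a b c = (b$1 - a$1) * (c$2 - a$2) - (b$2 - a$2) * (c$1 - a$1)"

lemma orient_swap: "orient a c b = - orient a b c"
  by (simp add: orient_def)

lemma orient_rotate: "orient b c a = orient a b c"
  by (simp add: orient_def algebra_simps)

lemma collinear_if_orient_eq_0:
  assumes "orient a b c = 0"
  shows "collinear {a, b, c}"
proof (cases "b = a")
  case True
  then show ?thesis by simp
next
  case False
  define u where "u = b - a"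
  define w where "w = c - a"
  have 0: "u$1 * w$2 = u$2 * w$1"
    using assms by (simp add: orient_def u_def w_def)
  have "\<exists>r. w = r *\<^sub>R u"
  proof (cases "u$1 = 0")
    case True
    with False have "u$2 \<noteq> 0"
      by (auto simp: u_def vec_eq_iff forall_2)
    with 0 True have "w = (w$2 / u$2) *\<^sub>R u"
      by (auto simp: vec_eq_iff forall_2)
    then show ?thesis ..
  next
    case nz: False
    with 0 have "w = (w$1 / u$1) *\<^sub>R u"
      by (auto simp: vec_eq_iff forall_2 field_simps)
    then show ?thesis ..
  qed
  then have "collinear {0, u, w}"
    by (auto simp: collinear_lemma)
  then have "collinear {b, a, c}"
    by (simp add: collinear_3 u_def w_def)
  then show ?thesis
    by (simp add: insert_commute)
qed

lemma orient_neq_0: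
  assumes "general_position V" "{a, b, c} \<subseteq> V" "a \<noteq> b" "a \<noteq> c" "b \<noteq> c"
  shows "orient a b c \<noteq> 0"
proof
  assume "orient a b c = 0"
  then have "collinear {a, b, c}" by (rule collinear_if_orient_eq_0)
  moreover have "card {a, b, c} = 3" using assms by simp
  ultimately show False
    using assms(1,2) unfolding general_position_def by blast
qed

text \<open>The three orientations are, up to the factor \<open>1 / S\<close>, the barycentric
  coordinates of \<open>x\<close>.\<close>

lemma in_convex_hull_triangle:
  assumes "orient x b c > 0" "orient a x c > 0" "orient a b x > 0"
  shows "x \<in> convex hull {a, b, c}"
proof -
  define S where "S = orient x b c + orient a x c + orient a b x"
  have S: "S > 0" using assms by (simp add: S_def)
  define u where "u = orient x b c / S"
  define v where "v = orient a x c / S"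
  define w where "w = orient a b x / S"
  have sum1: "u + v + w = 1"
    using S by (simp add: u_def v_def w_def S_def flip: add_divide_distrib)
  have "S *\<^sub>R x = orient x b c *\<^sub>R a + orient a x c *\<^sub>R b + orient a b x *\<^sub>R c"
    by (simp add: vec_eq_iff forall_2 S_def orient_def algebra_simps)
  then have "x = (1 / S) *\<^sub>R (orient x b c *\<^sub>R a + orient a x c *\<^sub>R b + orient a b x *\<^sub>R c)"
    using S by (metis divideR_right less_irrefl inverse_eq_divide)
  then have "x = u *\<^sub>R a + v *\<^sub>R b + w *\<^sub>R c"
    by (simp add: u_def v_def w_def scaleR_add_right)
  moreover have "0 \<le> u" "0 \<le> v" "0 \<le> w"
    using S assms by (auto simp: u_def v_def w_def)
  ultimately show ?thesis
    using sum1 unfolding convex_hull_3 by blast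
qed

lemma convex_position_not_in_triangle:
  assumes "convex_position V" "{x, a, b, c} \<subseteq> V" "x \<noteq> a" "x \<noteq> b" "x \<noteq> c"
  shows "\<not> (orient x b c > 0 \<and> orient a x c > 0 \<and> orient a b x > 0)"
proof
  assume "orient x b c > 0 \<and> orient a x c > 0 \<and> orient a b x > 0"
  then have "x \<in> convex hull {a, b, c}"
    using in_convex_hull_triangle by blast
  also have "\<dots> \<subseteq> convex hull (V - {x})"
    using assms(2-) by (intro hull_mono) auto
  finally show False
    using assms(1,2) by (auto simp: convex_position_def)
qed

text \<open>The hypotheses say that \<open>a\<close>, \<open>b\<close>, \<open>c\<close>,
  \<open>d\<close> form a counterclockwise convex quadrilateral; its diagonals meet.
  \<open>S\<close> is twice its area, split along \<open>bd\<close> or along \<open>ac\<close>, and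
  each diagonal is divided in the ratio of the two triangles that the other one cuts off.\<close>

lemma open_segments_meet:
  assumes "orient a b c > 0" "orient a b d > 0" "orient a c d > 0" "orient b c d > 0"
  shows "open_segment a c \<inter> open_segment b d \<noteq> {}"
proof -
  define S where "S = orient b c d + orient a b d"
  have S: "S > 0" using assms by (simp add: S_def)
  have S2: "S = orient a c d + orient a b c"
    by (simp add: S_def orient_def algebra_simps)
  define t where "t = orient a b d / S"
  define s where "s = orient a b c / S"
  have t1: "1 - t = orient b c d / S"
    using S by (simp add: t_def S_def field_simps)
  have s1: "1 - s = orient a c d / S"
    using S by (simp add: s_def S2 field_simps)
  have t01: "0 < t" "t < 1"
    using S assms t1 by (auto simp: t_def intro: divide_pos_pos) (simp add: S_def)
  have s01: "0 < s" "s < 1"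
    using S assms s1 by (auto simp: s_def intro: divide_pos_pos) (simp add: S2)
  \<comment> \<open>The affine dependence of four points in the plane; both sides are
    \<open>S\<close> times the crossing point.\<close>
  have "orient b c d *\<^sub>R a + orient a b d *\<^sub>R c = orient a c d *\<^sub>R b + orient a b c *\<^sub>R d"
    by (simp add: vec_eq_iff forall_2 orient_def algebra_simps)
  then have "(1/S) *\<^sub>R (orient b c d *\<^sub>R a + orient a b d *\<^sub>R c)
      = (1/S) *\<^sub>R (orient a c d *\<^sub>R b + orient a b c *\<^sub>R d)"
    by simp
  then have "(1 - t) *\<^sub>R a + t *\<^sub>R c = (1 - s) *\<^sub>R b + s *\<^sub>R d"
    unfolding t1 s1 by (simp add: t_def s_def scaleR_add_right)
  moreover have "a \<noteq> c" "b \<noteq> d"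
    using assms by (auto simp: orient_def)
  ultimately show ?thesis
    using t01 s01 unfolding in_segment disjoint_iff by metis
qed

lemma edges_cross_if_orient:
  assumes "orient a b c > 0" "orient a b d > 0" "orient a c d > 0" "orient b c d > 0"
  shows "edges_cross {a, c} {b, d}" "edges_cross {b, d} {a, c}"
proof -
  have ne: "a \<noteq> b" "a \<noteq> c" "a \<noteq> d" "b \<noteq> d"
    using assms by (auto simp: orient_def)
  have "rel_interior (convex hull {a, c}) = open_segment a c"
    "rel_interior (convex hull {b, d}) = open_segment b d"
    using ne by (simp_all flip: segment_convex_hull add: rel_interior_closed_segment)
  then show "edges_cross {a, c} {b, d}" "edges_cross {b, d} {a, c}"
    using open_segments_meet[OF assms] ne
    by (auto simp: edges_cross_def doubleton_eq_iff)
qed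

section \<open>Cyclic enumeration of a set in convex position\<close>

text \<open>The rank of an element, its number of predecessors, is strictly monotone and hence a
  bijection onto an initial segment; \<open>p\<close> is its inverse.\<close>

lemma strict_order_enumeration:
  assumes "finite V"
    and irrefl: "\<And>u. u \<in> V \<Longrightarrow> \<not> R u u"
    and trans: "\<And>u v w. \<lbrakk>u \<in> V; v \<in> V; w \<in> V; R u v; R v w\<rbrakk> \<Longrightarrow> R u w"
    and total: "\<And>u v. \<lbrakk>u \<in> V; v \<in> V; u \<noteq> v\<rbrakk> \<Longrightarrow> R u v \<or> R v u"
  obtains p where "bij_betw p {..<card V} V" "\<And>i j. i < j \<Longrightarrow> j < card V \<Longrightarrow> R (p i) (p j)"
proof -
  define f where "f v = card {u \<in> V. R u v}" for v
  have mono: "f u < f v" if "u \<in> V" "v \<in> V" "R u v" for u v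
  proof -
    have "{x \<in> V. R x u} \<subset> {x \<in> V. R x v}"
      using that trans irrefl by blast
    then show ?thesis
      unfolding f_def using \<open>finite V\<close> by (intro psubset_card_mono) auto
  qed
  have inj: "inj_on f V"
    by (rule inj_onI) (metis total mono less_irrefl)
  have "f v < card V" if "v \<in> V" for v
    unfolding f_def using that irrefl \<open>finite V\<close> by (intro psubset_card_mono) auto
  then have "f ` V = {..<card V}"
    using inj \<open>finite V\<close> by (intro card_subset_eq) (auto simp: card_image)
  with inj have f: "bij_betw f V {..<card V}"
    by (simp add: bij_betw_def)
  define p where "p = inv_into V f"
  have p: "bij_betw p {..<card V} V"
    unfolding p_def by (rule bij_betw_inv_into[OF f])
  show thesis
  proof (rule that[OF p])
    fix i j assume ij: "i < j" "j < card V"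
    then have pV: "p i \<in> V" "p j \<in> V"
      using p by (auto dest: bij_betwE)
    have fp: "f (p i) = i" "f (p j) = j"
      using ij f by (auto simp: p_def bij_betw_inv_into_right)
    then show "R (p i) (p j)"
      using total[OF pV] mono[OF pV(2,1)] ij by (metis not_less_iff_gr_or_eq)
  qed
qed

text \<open>Fix a vertex \<open>a\<close>, put it first and sort the others by angle around
  \<open>a\<close>. Convex position makes this a linear order and turns every increasing triple
  counterclockwise.\<close>

lemma convex_position_enumeration:
  assumes fin: "finite V" and gp: "general_position V" and cp: "convex_position V"
  obtains p where "bij_betw p {..<card V} V"
    "\<And>i j k. i < j \<Longrightarrow> j < k \<Longrightarrow> k < card V \<Longrightarrow> orient (p i) (p j) (p k) > 0"
proof (cases "V = {}")
  case True
  show ?thesis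
    by (rule that[of "\<lambda>_. undefined"]) (use True in \<open>auto simp: bij_betw_def\<close>)
next
  case False
  then obtain a where a: "a \<in> V" by blast
  define R where "R u v \<longleftrightarrow> v \<noteq> a \<and> (u = a \<or> orient a u v > 0)" for u v
  have tot: "R u v \<or> R v u" if "u \<in> V" "v \<in> V" "u \<noteq> v" for u v
    using orient_neq_0[OF gp, of a u v] a that orient_swap[of a u v]
    by (cases "u = a"; cases "v = a") (auto simp: R_def)
  have irr: "\<not> R u u" for u
    by (simp add: R_def orient_def)
  have R_orient: "orient u v w > 0" if "u \<in> V" "v \<in> V" "w \<in> V" "R u v" "R v w" for u v w
  proof (cases "u = a")
    case True
    then show ?thesis using that by (auto simp: R_def)
  next
    case False
    then have o: "orient a u v > 0" "orient a v w > 0" "v \<noteq> a" "w \<noteq> a"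
      using that by (auto simp: R_def)
    then have ne: "u \<noteq> v" "v \<noteq> w" by (auto simp: orient_def)
    have "u \<noteq> w"
      using o orient_swap[of a u v] by auto
    then have "orient u v w \<noteq> 0"
      using orient_neq_0[OF gp] that ne by auto
    \<comment> \<open>Otherwise \<open>v\<close> would lie inside the triangle
      \<open>a u w\<close>.\<close>
    moreover have "\<not> orient v u w > 0"
      using convex_position_not_in_triangle[OF cp, of v a u w] a that o ne by auto
    ultimately show ?thesis
      by (simp add: orient_def algebra_simps)
  qed
  have tr: "R u w" if V: "u \<in> V" "v \<in> V" "w \<in> V" and R: "R u v" "R v w" for u v w
  proof (cases "u = a")
    case True
    then show ?thesis using R by (auto simp: R_def)
  next
    case False
    then have o: "orient a u v > 0" "orient a v w > 0" "v \<noteq> a" "w \<noteq> a"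
      using R by (auto simp: R_def)
    have "u \<noteq> w"
      using o orient_swap[of a u v] by auto
    then have "orient a u w \<noteq> 0"
      using orient_neq_0[OF gp] a V False o by auto
    \<comment> \<open>Otherwise \<open>a\<close> would lie inside the triangle
      \<open>u v w\<close>.\<close>
    moreover have "\<not> orient u a w > 0"
      using convex_position_not_in_triangle[OF cp, of a u v w] a V o False
      by (auto simp: orient_rotate[of u v a])
    ultimately show ?thesis
      using o by (simp add: R_def orient_def algebra_simps)
  qed
  obtain p where p: "bij_betw p {..<card V} V"
    "\<And>i j. i < j \<Longrightarrow> j < card V \<Longrightarrow> R (p i) (p j)"
    by (rule strict_order_enumeration[of V R, OF fin]) (use irr tr tot in blast)+
  have "p i \<in> V" if "i < card V" for i
    using that p(1) by (auto dest: bij_betwE)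
  then show ?thesis
    by (intro that[OF p(1)] R_orient p(2)) auto
qed

section \<open>A vertex of small degree\<close>

text \<open>The sum is \<open>q * (q + 1) / 2\<close> for \<open>t \<le> q\<close> plus
  \<open>q\<close> for each later \<open>t\<close>; doubling and moving \<open>q * q\<close> to the
  left avoid division and subtraction on \<open>nat\<close>.\<close>

lemma sum_min_atLeast1:
  fixes q l :: nat
  assumes "q \<le> l"
  shows "2 * (\<Sum>t=1..l. min t q) + q * q = q + 2 * l * q"
  using assms
proof (induction l rule: dec_induct)
  case base
  have "(\<Sum>t=1..q. min t q) = (\<Sum>t=1..q. t)"
    by (intro sum.cong) auto
  also have "2 * \<dots> = q * (q + 1)"
    using gauss_sum_from_Suc_0[of q, where ?'a = nat] by simp
  finally show ?case by (simp add: algebra_simps)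
next
  case (step l)
  then show ?case by (simp add: algebra_simps)
qed

lemma sum_min_ends:
  fixes i j q :: nat
  assumes "i + q < j"
  shows "(\<Sum>u\<in>{i<..<j}. min (u - i) q + min (j - u) q) + q * q = q + 2 * (j - i - 1) * q"
proof -
  have 1: "(\<Sum>u\<in>{i<..<j}. min (u - i) q) = (\<Sum>t=1..j-i-1. min t q)"
    by (rule sum.reindex_bij_witness[of _ "\<lambda>t. i + t" "\<lambda>u. u - i"]) auto
  have 2: "(\<Sum>u\<in>{i<..<j}. min (j - u) q) = (\<Sum>t=1..j-i-1. min t q)"
    by (rule sum.reindex_bij_witness[of _ "\<lambda>t. j - t" "\<lambda>u. j - u"]) auto
  show ?thesis
    using sum_min_atLeast1[of q "j - i - 1"] assms by (simp add: sum.distrib 1 2 flip: mult_2)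
qed

text \<open>The combinatorial core, on vertex indices only. A counted pair is an edge with one end
  strictly between \<open>i\<close> and \<open>j\<close> and the other outside
  \<open>{i..j}\<close>; in the convex drawing it crosses the edge \<open>ij\<close>.\<close>

lemma exists_edge_with_many_crossings:
  fixes A :: "nat \<Rightarrow> nat \<Rightarrow> bool"
  assumes sym: "\<And>u v. A u v \<Longrightarrow> A v u" and irr: "\<And>u. \<not> A u u"
    and bd: "\<And>u v. A u v \<Longrightarrow> v < n" and "n > 0"
    and deg: "\<And>u. u < n \<Longrightarrow> D < card {v. A u v}"
  obtains i j where "i < j" "A i j"
    "(D div 2) * (D - D div 2) \<le> card (SIGMA u:{i<..<j}. {v. A u v \<and> v \<notin> {i..j}})"
proof -
  define q where "q = D div 2"
  have fin: "finite {v. A u v}" for u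
    by (rule finite_subset[of _ "{..<n}"]) (use bd in auto)
  \<comment> \<open>\<open>P d\<close>: some edge has length \<open>d\<close> and at least
    \<open>q\<close> indices strictly between its ends.\<close>
  define P where "P d \<longleftrightarrow> (\<exists>i j. A i j \<and> i + q < j \<and> d = j - i)" for d
  \<comment> \<open>More than \<open>D\<close> positive neighbours of \<open>0\<close> cannot all be
    at most \<open>D\<close>; as \<open>q \<le> D\<close>, such an edge witnesses
    \<open>P\<close>.\<close>
  have "\<exists>v. A 0 v \<and> D < v"
  proof (rule ccontr)
    assume "\<not> ?thesis"
    then have "{v. A 0 v} \<subseteq> {1..D}"
      using irr by (auto simp: not_less Suc_le_eq intro!: gr0I)
    then have "card {v. A 0 v} \<le> card {1..D}"
      by (intro card_mono) auto
    then show False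
      using deg[of 0] \<open>n > 0\<close> by simp
  qed
  then have "\<exists>d. P d"
    unfolding P_def q_def by force
  then have "P (LEAST d. P d)"
    by (rule LeastI_ex)
  then obtain i j where ij: "A i j" "i + q < j" "(LEAST d. P d) = j - i"
    unfolding P_def by metis
  \<comment> \<open>A longer edge within \<open>{i..j}\<close> other than \<open>ij\<close> would
    contradict the minimality of \<open>j - i\<close>.\<close>
  have short: "v \<le> u + q" if "A u v" "i \<le> u" "v \<le> j" "u \<noteq> i \<or> v \<noteq> j" for u v
  proof (rule ccontr)
    assume "\<not> ?thesis"
    then have "P (v - u)"
      using that(1) unfolding P_def by (metis not_less)
    then have "j - i \<le> v - u"
      using ij(3) Least_le by metis
    then show False
      using that \<open>\<not> v \<le> u + q\<close> ij(2) by auto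
  qed
  \<comment> \<open>Within \<open>{i..j}\<close>, all neighbours of \<open>u\<close> are at distance
    at most \<open>q\<close> on either side; the rest of its more than \<open>D\<close> neighbours
    lie outside.\<close>
  have far: "D + 1 \<le> card {v. A u v \<and> v \<notin> {i..j}} + (min (u - i) q + min (j - u) q)"
    if u: "u \<in> {i<..<j}" for u
  proof -
    have "u < n"
      using u bd[OF ij(1)] by simp
    have "{v. A u v \<and> v \<in> {i..j}} \<subseteq> {u - min (u - i) q..<u} \<union> {u<..u + min (j - u) q}"
    proof
      fix v assume v: "v \<in> {v. A u v \<and> v \<in> {i..j}}"
      then have "v \<noteq> u" using irr by auto
      moreover have "v \<le> u + q" "u \<le> v + q"
        using short[of u v] short[of v u] sym v u by auto
      ultimately show "v \<in> {u - min (u - i) q..<u} \<union> {u<..u + min (j - u) q}"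
        using v u by (auto simp: min_def)
    qed
    then have "card {v. A u v \<and> v \<in> {i..j}}
        \<le> card ({u - min (u - i) q..<u} \<union> {u<..u + min (j - u) q})"
      by (intro card_mono) auto
    also have "\<dots> \<le> min (u - i) q + min (j - u) q"
      by (rule order_trans[OF card_Un_le]) simp
    finally have near: "card {v. A u v \<and> v \<in> {i..j}} \<le> min (u - i) q + min (j - u) q" .
    have "{v. A u v} = {v. A u v \<and> v \<notin> {i..j}} \<union> {v. A u v \<and> v \<in> {i..j}}"
      by blast
    then have "card {v. A u v} \<le> card {v. A u v \<and> v \<notin> {i..j}} + card {v. A u v \<and> v \<in> {i..j}}"
      by (metis card_Un_le)
    then show ?thesis
      using near deg[OF \<open>u < n\<close>] by linarith
  qed
  define X where "X = (\<Sum>u\<in>{i<..<j}. card {v. A u v \<and> v \<notin> {i..j}})"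
  define l where "l = j - i - 1"
  have "l * (D + 1) = (\<Sum>u\<in>{i<..<j}. D + 1)"
    by (simp add: l_def)
  also have "\<dots> \<le> (\<Sum>u\<in>{i<..<j}. card {v. A u v \<and> v \<notin> {i..j}} + (min (u - i) q + min (j - u) q))"
    by (intro sum_mono far)
  also have "\<dots> = X + (\<Sum>u\<in>{i<..<j}. min (u - i) q + min (j - u) q)"
    by (simp only: sum.distrib X_def)
  finally have *: "l * (D + 1) + q * q \<le> X + (q + 2 * l * q)"
    using sum_min_ends[OF ij(2)] by (simp add: l_def)
  obtain r where r: "D = 2 * q + r"
    unfolding q_def by (metis mult_div_mod_eq)
  \<comment> \<open>With \<open>D = 2 * q + r\<close> the terms \<open>2 * l * q\<close> in
    \<open>*\<close> cancel, leaving \<open>l * (r + 1) + q * q \<le> X + q\<close>. Now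
    \<open>l \<ge> q\<close> gives \<open>X \<ge> q * (q + r)\<close>, and
    \<open>q + r = D - q\<close>.\<close>
  have "q * (r + 1) \<le> l * (r + 1)"
    using ij(2) by (intro mult_right_mono) (auto simp: l_def)
  then have "q * (D - q) \<le> X"
    using * unfolding r by (simp add: algebra_simps)
  moreover have "X = card (SIGMA u:{i<..<j}. {v. A u v \<and> v \<notin> {i..j}})"
    unfolding X_def by (subst card_SigmaI) (auto intro: finite_subset[OF _ fin])
  ultimately show thesis
    using that[of i j] ij(1,2) by (simp add: q_def)
qed

lemma convex_k_plane_small_degree:
  assumes G: "convex_geometric_graph V E" and kp: "k_plane k E" and "V \<noteq> {}"
    and k: "k < (D div 2) * (D - D div 2)"
  shows "\<exists>v\<in>V. card {e\<in>E. v \<in> e} \<le> D"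
proof (rule ccontr)
  assume "\<not> ?thesis"
  then have big: "D < card {e\<in>E. v \<in> e}" if "v \<in> V" for v
    using that by (auto simp: not_le)
  have fin: "finite V" and gp: "general_position V" and cp: "convex_position V"
    and E: "E \<subseteq> {e. e \<subseteq> V \<and> card e = 2}"
    using G by (auto simp: convex_geometric_graph_def geometric_graph_def)
  have finE: "finite E"
    by (rule finite_subset[of _ "Pow V"]) (use E fin in auto)
  obtain p where p: "bij_betw p {..<card V} V"
    and orp: "\<And>i j k. i < j \<Longrightarrow> j < k \<Longrightarrow> k < card V \<Longrightarrow> orient (p i) (p j) (p k) > 0"
    using convex_position_enumeration[OF fin gp cp] by blast
  have inj: "p u = p v \<longleftrightarrow> u = v" if "u < card V" "v < card V" for u v
    using p that by (auto simp: bij_betw_def inj_on_def)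
  define A where "A u v \<longleftrightarrow> u < card V \<and> v < card V \<and> {p u, p v} \<in> E" for u v
  have irr: "\<not> A u u" for u
    using E by (auto simp: A_def)
  have deg: "D < card {v. A u v}" if u: "u < card V" for u
  proof -
    have pu: "p u \<in> V" using p u by (auto dest: bij_betwE)
    have "{e\<in>E. p u \<in> e} \<subseteq> (\<lambda>v. {p u, p v}) ` {v. A u v}"
    proof
      fix e assume e: "e \<in> {e\<in>E. p u \<in> e}"
      then obtain x where x: "e = {p u, x}"
        using E by (auto simp: card_2_iff)
      then have "x \<in> V" using e E by auto
      then obtain v where "v < card V" "x = p v"
        using p by (auto simp: bij_betw_def)
      then show "e \<in> (\<lambda>v. {p u, p v}) ` {v. A u v}"
        using x e u by (auto simp: A_def)
    qed
    then have "card {e\<in>E. p u \<in> e} \<le> card {v. A u v}"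
      by (rule surj_card_le[rotated]) (auto simp: A_def)
    then show ?thesis using big[OF pu] by simp
  qed
  obtain i j where ij: "i < j" "A i j"
    and many: "(D div 2) * (D - D div 2) \<le> card (SIGMA u:{i<..<j}. {v. A u v \<and> v \<notin> {i..j}})"
  proof (rule exists_edge_with_many_crossings)
    show "A v u" if "A u v" for u v
      using that by (simp add: A_def insert_commute)
    show "v < card V" if "A u v" for u v
      using that by (simp add: A_def)
    show "0 < card V"
      using \<open>V \<noteq> {}\<close> fin by (simp add: card_gt_0_iff)
  qed (use irr deg in auto)
  let ?S = "SIGMA u:{i<..<j}. {v. A u v \<and> v \<notin> {i..j}}"
  let ?f = "\<lambda>(u, v). {p u, p v}"
  \<comment> \<open>No edge is counted twice: exactly one of its ends has an index strictly between
    \<open>i\<close> and \<open>j\<close>, which fixes the order of the pair.\<close>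
  have "inj_on ?f ?S"
    by (rule inj_onI) (auto simp: doubleton_eq_iff A_def inj)
  moreover have "?f ` ?S \<subseteq> {f \<in> E. edges_cross {p i, p j} f}"
  proof clarify
    fix u v assume uv: "u \<in> {i<..<j}" "A u v" "v \<notin> {i..j}"
    then have lt: "i < u" "u < j" "j < card V" "v < card V"
      using ij by (auto simp: A_def)
    \<comment> \<open>The counterclockwise order of the four ends is \<open>v, i, u, j\<close> or
      \<open>i, u, j, v\<close>; in both, \<open>ij\<close> and \<open>uv\<close> are the
      diagonals.\<close>
    consider "v < i" | "j < v" using uv by fastforce
    then have "edges_cross {p i, p j} {p u, p v}"
    proof cases
      case 1
      then show ?thesis
        using edges_cross_if_orient(2)[of "p v" "p i" "p u" "p j"] lt
        by (simp add: orp insert_commute)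
    next
      case 2
      then show ?thesis
        using edges_cross_if_orient(1)[of "p i" "p u" "p j" "p v"] lt
        by (simp add: orp)
    qed
    then show "{p u, p v} \<in> E \<and> edges_cross {p i, p j} {p u, p v}"
      using uv by (simp add: A_def)
  qed
  ultimately have "card ?S \<le> card {f \<in> E. edges_cross {p i, p j} f}"
    using finE by (intro card_inj_on_le[of ?f]) auto
  also have "\<dots> \<le> k"
    using kp ij by (auto simp: k_plane_def A_def)
  finally show False
    using many k by simp
qed

section \<open>Edge count and the numerical bound\<close>

lemma convex_k_plane_card_edges_le:
  assumes "convex_geometric_graph V E" "k_plane k E" "k < (D div 2) * (D - D div 2)"
  shows "card E \<le> D * card V"
  using assms(1,2)
proof (induction "card V" arbitrary: V E)
  case 0
  then have "V = {}" "E \<subseteq> {e. e \<subseteq> V \<and> card e = 2}"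
    by (auto simp: convex_geometric_graph_def geometric_graph_def)
  then have "E = {}" by auto
  then show ?case by simp
next
  case (Suc m)
  have V: "finite V" "V \<noteq> {}" and E: "E \<subseteq> {e. e \<subseteq> V \<and> card e = 2}"
    using Suc.hyps(2) Suc.prems(1)
    by (auto simp: convex_geometric_graph_def geometric_graph_def)
  have finE: "finite E"
    by (rule finite_subset[of _ "Pow V"]) (use E V in auto)
  obtain v where v: "v \<in> V" "card {e\<in>E. v \<in> e} \<le> D"
    using convex_k_plane_small_degree[OF Suc.prems V(2) assms(3)] by blast
  \<comment> \<open>Deleting \<open>v\<close> loses at most \<open>D\<close> edges, and the
    remaining graph is again convex and \<open>k\<close>-plane with the same
    \<open>k\<close>.\<close>
  define E' where "E' = {e\<in>E. v \<notin> e}"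
  have "convex_position (V - {v})"
    unfolding convex_position_def
  proof
    fix x assume "x \<in> V - {v}"
    moreover have "convex hull (V - {v} - {x}) \<subseteq> convex hull (V - {x})"
      by (intro hull_mono) auto
    ultimately show "x \<notin> convex hull (V - {v} - {x})"
      using Suc.prems(1) by (auto simp: convex_geometric_graph_def convex_position_def)
  qed
  moreover have "general_position (V - {v})"
    using Suc.prems(1)
    by (auto simp: convex_geometric_graph_def geometric_graph_def general_position_def)
  ultimately have "convex_geometric_graph (V - {v}) E'"
    using V(1) E by (auto simp: convex_geometric_graph_def geometric_graph_def E'_def)
  moreover have "k_plane k E'"
    unfolding k_plane_def
  proof
    fix e assume "e \<in> E'"
    have "card {f \<in> E'. edges_cross e f} \<le> card {f \<in> E. edges_cross e f}"
      using finE by (intro card_mono) (auto simp: E'_def)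
    then show "card {f \<in> E'. edges_cross e f} \<le> k"
      using Suc.prems(2) \<open>e \<in> E'\<close> by (force simp: k_plane_def E'_def)
  qed
  moreover have m: "m = card (V - {v})"
    using Suc.hyps(2) v V by simp
  ultimately have "card E' \<le> D * m"
    using Suc.hyps(1)[of "V - {v}" E'] by simp
  moreover have "card E \<le> card E' + card {e\<in>E. v \<in> e}"
    by (rule order_trans[OF _ card_Un_le], rule card_mono) (use finE in \<open>auto simp: E'_def\<close>)
  ultimately show ?case
    using v(2) by (simp flip: Suc.hyps(2))
qed

theorem theorem6:
  fixes k n :: nat and V :: "point set" and E :: "point set set"
  assumes "k \<ge> 5"
    and "convex_geometric_graph V E"
    and "k_plane k E"
    and "card V = n"
  shows "real (card E) \<le> sqrt (243 / 40 * real k) * real n"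
proof -
  define Q where "Q D \<longleftrightarrow> k < (D div 2) * (D - D div 2)" for D
  define D where "D = (LEAST D. Q D)"
  \<comment> \<open>Here the product is \<open>(k + 1) * (k + 1) > k\<close>, so a least
    \<open>D\<close> exists.\<close>
  have "Q (2 * (k + 1))" by (simp add: Q_def)
  then have D: "Q D" unfolding D_def by (rule LeastI)
  then have "D \<noteq> 0" by (auto simp: Q_def intro: gr0I)
  then obtain x where x: "D = Suc x" by (cases D) auto
  then have "\<not> Q x"
    using not_less_Least[of x Q] by (simp add: D_def)
  then have "(x div 2) * (x - x div 2) \<le> k" by (simp add: Q_def)
  \<comment> \<open>The product is \<open>x * x / 4\<close> rounded down; the summand 1 covers odd
    \<open>x\<close>.\<close>
  moreover have "x * x \<le> 4 * ((x div 2) * (x - x div 2)) + 1"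
    by (cases "even x") (auto elim!: evenE oddE simp: algebra_simps)
  ultimately have "x * x \<le> 4 * k + 1" by linarith
  then have xk: "real x * real x \<le> 4 * real k + 1"
    by (metis (mono_tags) of_nat_le_iff of_nat_mult of_nat_add of_nat_numeral of_nat_1)
  have "(real D)\<^sup>2 \<le> 243 / 40 * real k"
  \<comment> \<open>For \<open>x \<le> 4\<close> the bound is \<open>25 \<le> 243 / 8\<close>, from
    \<open>k \<ge> 5\<close>. For \<open>x \<ge> 5\<close>, the inequality
    \<open>(x - 5) * (x + 1) \<ge> 0\<close> is equivalent to
    \<open>(x + 1)\<^sup>2 \<le> 3 / 2 * (x\<^sup>2 - 1)\<close>, and the right side is at most
    \<open>6 * k\<close>.\<close>
  proof (cases "x \<le> 4")
    case True
    then have "(real D)\<^sup>2 \<le> 5\<^sup>2"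
      by (intro power_mono) (auto simp: x)
    then show ?thesis using \<open>k \<ge> 5\<close> by simp
  next
    case False
    then have "0 \<le> (real x - 5) * (real x + 1)" by simp
    moreover have "(real D)\<^sup>2 = real x * real x + 2 * real x + 1"
      by (simp add: x power2_eq_square algebra_simps)
    ultimately show ?thesis
      using xk False by (simp add: algebra_simps)
  qed
  then have "real D \<le> sqrt (243 / 40 * real k)"
    by (rule real_le_rsqrt)
  moreover have "card E \<le> D * n"
    using convex_k_plane_card_edges_le[OF assms(2,3)] D assms(4) by (simp add: Q_def)
  then have "real (card E) \<le> real D * real n"
    by (metis of_nat_le_iff of_nat_mult)
  ultimately show ?thesis
    by (meson mult_right_mono of_nat_0_le_iff order_trans)
qed

end
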